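(* Let $\mathcal A=(V,\mathcal R)$ be a symmetric association scheme with $d$ classes, with adjacency matrices $A_0,\dots,A_d$, maximal common eigenspaces $W_0,\dots,W_d$ of $\mathbf C^V$, primitive idempotents $E_0,\dots,E_d$ ($E_j$ being the orthogonal projection onto $W_j$), and eigenvalues $P_{ji}$ ($P_{ji}$ being the eigenvalue of $A_i$ on $W_j$). Let $\pi=\{C_1,\dots,C_t\}$ be an equitable partition of $\mathcal A$ with characteristic matrix $H$, quotient matrices $N_0,\dots,N_d$ (so that $A_iH=HN_i$), and let $F$ be the matrix of the orthogonal projection of $\mathbf C^V$ onto the column space of $H$. Then for every $0\le j\le d$, $$\langle F,E_j\rangle=m_j,$$ where $m_j=\dim(W_jH)$ is, for every $0\le i\le d$, the multiplicity of $P_{ji}$ as an eigenvalue of $N_i$ on the space $W_jH$ (that is, $W_jH$ has dimension $m_j$ and $uN_i=P_{ji}u$ for all row vectors $u\in W_jH$ and all $0\le i\le d$).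
   Context: Association scheme: $V$ is a finite set of size $v$, $\mathcal R=\{R_0,\dots,R_d\}$ is a set of non-empty subsets of $V\times V$, and $A_i\in\mathbf C^{V\times V}$ is the $0/1$ adjacency matrix of $(V,R_i)$. The pair $\mathcal A=(V,\mathcal R)$ is an association scheme with $d$ classes if: (1) $A_0=I$; (2) $\sum_{i=0}^d A_i=J$ (the all-ones matrix); (3) $A_i^{T}\in\{A_0,\dots,A_d\}$ for every $i$; (4) $A_iA_j$ is a linear combination of $A_0,\dots,A_d$ for all $i,j$. It is symmetric if all $A_i$ are symmetric matrices. The Bose–Mesner algebra $\mathbf C[\mathcal A]$ is the matrix algebra generated by $A_0,\dots,A_d$; it has basis $A_0,\dots,A_d$ and is commutative in the symmetric case. Eigenspaces: for symmetric $\mathcal A$, $\mathbf C^V=W_0\oplus W_1\oplus\dots\oplus W_d$ is the orthogonal direct sum of the $d+1$ maximal common eigenspaces of $A_0,\dots,A_d$. $E_j$ is the orthogonal projection onto $W_j$; the $E_j$ form a second basis of $\mathbf C[\mathcal A]$. The numbers $P_{ji}$ are defined by $A_i=\sum_{j=0}^d P_{ji}E_j$. Inner product: $\langle M,N\rangle=\mathrm{tr}(M^{*}N)$ for $M,N\in\mathbf C^{V\times V}$. Partitions: let $\pi$ be a partition of $V$ into $t$ (non-empty) cells $C_1,\dots,C_t$. Its characteristic matrix $H$ is the $v\times t$ matrix whose columns are the characteristic vectors of the cells. $\pi$ is an equitable partition of $\mathcal A$ if the column space of $H$ is $\mathbf C[\mathcal A]$-invariant, i.e. for every $A\in\mathbf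 C[\mathcal A]$ there is a $t\times t$ matrix $B$ (the quotient matrix of $A$) with $AH=HB$. Equivalently, for all $0\le i\le d$, $1\le j,k\le t$ and every $x\in C_k$, the number of $y\in C_j$ with $(x,y)\in R_i$ is a constant $n_{ij}^k$ independent of the choice of $x\in C_k$; the quotient matrix of $A_i$ is $N_i$ with $(N_i)_{k,j}=n_{ij}^k$. Projection matrix: with $D=H^{T}H$ (the diagonal matrix with $D_{i,i}=|C_i|$), the orthogonal projection onto the column space of $H$ is $F=HD^{-1}H^{T}$; explicitly $F_{x,y}=1/|C_k|$ if $x,y$ lie in the same cell $C_k$, and $F_{x,y}=0$ otherwise. The space $W_jH$: viewing the elements of $W_j$ as row vectors, $W_jH=\{wH : w\in W_j\}\subseteq\mathbf C^{t}$ (row vectors). *)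

theory Defs
  imports "HOL-Analysis.Analysis" "HOL-Library.Disjoint_Sets"
begin

section \<open>Complex matrices\<close>

(* The library operator *s on a matrix type scales rows by a vector, not by a scalar. *)
definition matrix_scale :: "complex \<Rightarrow> complex^'n^'m \<Rightarrow> complex^'n^'m" where
  "matrix_scale c M = (\<chi> x y. c * M $ x $ y)"

definition conj_transpose :: "complex^'n^'m \<Rightarrow> complex^'m^'n" where
  "conj_transpose M = (\<chi> x y. cnj (M $ y $ x))"

definition matrix_inner :: "complex^'n^'n \<Rightarrow> complex^'n^'n \<Rightarrow> complex" where
  "matrix_inner M N = trace (conj_transpose M ** N)"

(* The Hermitian inner product; the library's inner on complex^'n is only its real part. *)
definition herm_inner :: "complex^'n \<Rightarrow> complex^'n \<Rightarrow> complex" where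
  "herm_inner x y = (\<Sum>i\<in>UNIV. cnj (x $ i) * y $ i)"

definition is_orth_projection :: "complex^'n^'n \<Rightarrow> (complex^'n) set \<Rightarrow> bool" where
  "is_orth_projection E U \<longleftrightarrow>
     (\<forall>x. E *v x \<in> U \<and> (\<forall>u\<in>U. herm_inner u (x - E *v x) = 0))"

definition column_space :: "complex^'n^'m \<Rightarrow> (complex^'m) set" where
  "column_space M = vec.span (columns M)"


section \<open>Association schemes\<close>

text \<open>
  The finite vertex set is the type \<open>'v\<close>. A scheme with \<open>d\<close> classes is given by its relations
  \<open>R 0, \<dots>, R d\<close>; values \<open>R i\<close> with \<open>i > d\<close> are irrelevant. That the relations are pairwise
  distinct follows from their being non-empty and their adjacency matrices summing to the
  all-ones matrix.
\<close>

definition adj :: "('v::finite \<times> 'v) set \<Rightarrow> complex^'v^'v" where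
  "adj S = (\<chi> x y. if (x, y) \<in> S then 1 else 0)"

definition association_scheme :: "nat \<Rightarrow> (nat \<Rightarrow> ('v::finite \<times> 'v) set) \<Rightarrow> bool" where
  "association_scheme d R \<longleftrightarrow>
     (\<forall>i\<le>d. R i \<noteq> {}) \<and>
     adj (R 0) = mat 1 \<and>
     (\<Sum>i\<le>d. adj (R i)) = (\<chi> x y. 1) \<and>
     (\<forall>i\<le>d. transpose (adj (R i)) \<in> (\<lambda>k. adj (R k)) ` {..d}) \<and>
     (\<forall>i\<le>d. \<forall>j\<le>d. \<exists>p. adj (R i) ** adj (R j) = (\<Sum>k\<le>d. matrix_scale (p k) (adj (R k))))"

definition symmetric_scheme :: "nat \<Rightarrow> (nat \<Rightarrow> ('v::finite \<times> 'v) set) \<Rightarrow> bool" where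
  "symmetric_scheme d R \<longleftrightarrow>
     association_scheme d R \<and> (\<forall>i\<le>d. transpose (adj (R i)) = adj (R i))"

inductive_set bose_mesner :: "nat \<Rightarrow> (nat \<Rightarrow> ('v::finite \<times> 'v) set) \<Rightarrow> (complex^'v^'v) set"
  for d :: nat and R :: "nat \<Rightarrow> ('v \<times> 'v) set" where
  generator: "i \<le> d \<Longrightarrow> adj (R i) \<in> bose_mesner d R"
| scale: "M \<in> bose_mesner d R \<Longrightarrow> matrix_scale c M \<in> bose_mesner d R"
| add: "M \<in> bose_mesner d R \<Longrightarrow> N \<in> bose_mesner d R \<Longrightarrow> M + N \<in> bose_mesner d R"
| mult: "M \<in> bose_mesner d R \<Longrightarrow> N \<in> bose_mesner d R \<Longrightarrow> M ** N \<in> bose_mesner d R"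

definition common_eigenspace ::
  "nat \<Rightarrow> (nat \<Rightarrow> ('v::finite \<times> 'v) set) \<Rightarrow> (complex^'v) set \<Rightarrow> bool" where
  "common_eigenspace d R U \<longleftrightarrow>
     vec.subspace U \<and> U \<noteq> {0} \<and> (\<forall>i\<le>d. \<exists>\<theta>. \<forall>w\<in>U. adj (R i) *v w = \<theta> *s w)"

definition maximal_common_eigenspace ::
  "nat \<Rightarrow> (nat \<Rightarrow> ('v::finite \<times> 'v) set) \<Rightarrow> (complex^'v) set \<Rightarrow> bool" where
  "maximal_common_eigenspace d R U \<longleftrightarrow>
     common_eigenspace d R U \<and> (\<forall>U'. common_eigenspace d R U' \<and> U \<subseteq> U' \<longrightarrow> U' = U)"


section \<open>Equitable partitions\<close>

text \<open>The cells of a partition of \<open>'v\<close> are indexed by the finite type \<open>'t\<close>.\<close>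

definition cell_partition :: "('t::finite \<Rightarrow> 'v::finite set) \<Rightarrow> bool" where
  "cell_partition C \<longleftrightarrow> inj C \<and> partition_on UNIV (range C)"

definition char_matrix :: "('t::finite \<Rightarrow> 'v::finite set) \<Rightarrow> complex^'t^'v" where
  "char_matrix C = (\<chi> x k. if x \<in> C k then 1 else 0)"

definition quotient_matrix ::
  "('t::finite \<Rightarrow> 'v::finite set) \<Rightarrow> complex^'v^'v \<Rightarrow> complex^'t^'t \<Rightarrow> bool" where
  "quotient_matrix C M B \<longleftrightarrow> M ** char_matrix C = char_matrix C ** B"

definition equitable_partition ::
  "nat \<Rightarrow> (nat \<Rightarrow> ('v::finite \<times> 'v) set) \<Rightarrow> ('t::finite \<Rightarrow> 'v set) \<Rightarrow> bool" where
  "equitable_partition d R C \<longleftrightarrow>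
     cell_partition C \<and> (\<forall>M\<in>bose_mesner d R. \<exists>B. quotient_matrix C M B)"

(* The space W H for a space W of row vectors; there is no conjugation. *)
definition row_image :: "(complex^'m) set \<Rightarrow> complex^'n^'m \<Rightarrow> (complex^'n) set" where
  "row_image W H = (\<lambda>w. w v* H) ` W"

definition left_eigen_multiplicity ::
  "complex^'n^'n \<Rightarrow> complex \<Rightarrow> (complex^'n) set \<Rightarrow> nat" where
  "left_eigen_multiplicity N \<theta> U = vec.dim {u \<in> U. u v* N = \<theta> *s u}"

end

theory Submission
  imports Defs
begin

text \<open>
  Maximality makes \<open>W j\<close> the set of all vectors on which every \<open>A i\<close> acts as \<open>P j i\<close>. The column
  space of \<open>H\<close> is invariant under the Hermitian matrices \<open>A i\<close>, so \<open>F\<close> commutes with each of them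
  and maps \<open>W j\<close> into itself. Hence \<open>F ** E j\<close> is idempotent and its trace is the dimension of its
  range \<open>F W j\<close>. Finally the transpose of \<open>H\<close> is injective on the column space of \<open>H\<close> and
  annihilates its orthogonal complement, so it maps \<open>F W j\<close> isomorphically onto \<open>W j H\<close>.
\<close>

section \<open>Traces of idempotent matrices\<close>

text \<open>Expand each column of \<open>M\<close> in a basis \<open>B\<close> of the range.
  Exchanging the sums turns the trace into the sum over \<open>b\<close> in \<open>B\<close> of the
  \<open>b\<close>-coordinate of \<open>M *v b\<close>, which is 1 because an idempotent fixes its
  range.\<close>

lemma trace_idempotent:
  fixes M :: "'a::field^'n^'n"
  assumes idem: "M ** M = M"
  shows "trace M = of_nat (vec.dim (range ((*v) M)))"
proof -
  let ?U = "range ((*v) M)"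
  obtain B where B: "B \<subseteq> ?U" "vec.independent B" "?U \<subseteq> vec.span B" "card B = vec.dim ?U"
    using vec.basis_exists by blast
  have fin: "finite B"
    using B(2) vec.finiteI_independent by blast
  let ?r = "vec.representation B"
  have inspan: "M *v x \<in> vec.span B" for x
    using B(3) by blast
  have Mb: "M *v b = b" if "b \<in> B" for b
    using B(1) that idem by (auto simp: matrix_vector_mul_assoc)
  have expand: "M *v x = (\<Sum>b\<in>B. ?r (M *v x) b *s b)" for x
    using vec.sum_representation_eq[OF B(2) inspan fin subset_refl] by simp
  have "trace M = (\<Sum>x\<in>UNIV. (M *v axis x 1) $ x)"
    by (simp add: trace_def matrix_vector_mult_def axis_def if_distrib cong: if_cong)
  also have "\<dots> = (\<Sum>x\<in>UNIV. \<Sum>b\<in>B. ?r (M *v axis x 1) b * b $ x)"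
  proof (rule sum.cong[OF refl])
    fix x
    show "(M *v axis x 1) $ x = (\<Sum>b\<in>B. ?r (M *v axis x 1) b * b $ x)"
      by (subst expand) simp
  qed
  also have "\<dots> = (\<Sum>b\<in>B. \<Sum>x\<in>UNIV. ?r (M *v axis x 1) b * b $ x)"
    by (rule sum.swap)
  also have "\<dots> = (\<Sum>b\<in>B. ?r (M *v b) b)"
  proof (rule sum.cong[OF refl])
    fix b
    \<comment> \<open>Coordinates are linear, so expanding \<open>b\<close> in the standard basis
      collapses the inner sum to a single coordinate.\<close>
    have "M *v b = M *v (\<Sum>x\<in>UNIV. b $ x *s axis x 1)"
      by (simp only: basis_expansion)
    also have "\<dots> = (\<Sum>x\<in>UNIV. b $ x *s (M *v axis x 1))"
      by (simp add: vec.linear_sum[OF matrix_vector_mul_linear_gen] vector_scalar_commute)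
    finally have "?r (M *v b) b = (\<Sum>x\<in>UNIV. ?r (b $ x *s (M *v axis x 1)) b)"
      using B(2) inspan by (simp add: vec.representation_sum vec.span_scale)
    then show "(\<Sum>x\<in>UNIV. ?r (M *v axis x 1) b * b $ x) = ?r (M *v b) b"
      using B(2) inspan by (simp add: vec.representation_scale mult.commute)
  qed
  also have "\<dots> = (\<Sum>b\<in>B. 1)"
    using Mb B(2) by (intro sum.cong) (simp_all add: vec.representation_basis)
  finally show ?thesis
    using B(4) by simp
qed


section \<open>The Hermitian inner product\<close>

lemma herm_inner_diff_right: "herm_inner x (y - z) = herm_inner x y - herm_inner x z"
  by (simp add: herm_inner_def right_diff_distrib sum_subtractf)

lemma herm_inner_scale_right: "herm_inner x (c *s y) = c * herm_inner x y"
  by (simp add: herm_inner_def sum_distrib_left mult.left_commute)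

lemma herm_inner_commute: "herm_inner y x = cnj (herm_inner x y)"
  by (simp add: herm_inner_def mult.commute)

lemma herm_inner_scale_left: "herm_inner (c *s x) y = cnj c * herm_inner x y"
  by (simp add: herm_inner_def sum_distrib_left mult.assoc)

lemma herm_inner_zero_left [simp]: "herm_inner 0 y = 0"
  by (simp add: herm_inner_def)

lemma herm_inner_self_eq_0: "herm_inner x x = 0 \<longleftrightarrow> x = 0"
proof
  assume "herm_inner x x = 0"
  moreover have "herm_inner x x = complex_of_real (\<Sum>i\<in>UNIV. (cmod (x $ i))\<^sup>2)"
    by (simp add: herm_inner_def complex_norm_square mult.commute del: of_real_power)
  ultimately have "(\<Sum>i\<in>UNIV. (cmod (x $ i))\<^sup>2) = 0"
    by (metis of_real_eq_0_iff)
  then show "x = 0"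
    by (simp add: sum_nonneg_eq_0_iff vec_eq_iff)
qed simp

lemma herm_inner_conj_transpose:
  "herm_inner (conj_transpose M *v x) y = herm_inner x (M *v y)"
proof -
  have "herm_inner (conj_transpose M *v x) y = (\<Sum>i\<in>UNIV. \<Sum>k\<in>UNIV. M $ k $ i * cnj (x $ k) * y $ i)"
    by (simp add: herm_inner_def conj_transpose_def matrix_vector_mult_def sum_distrib_right)
  also have "\<dots> = (\<Sum>k\<in>UNIV. \<Sum>i\<in>UNIV. M $ k $ i * cnj (x $ k) * y $ i)"
    by (rule sum.swap)
  also have "\<dots> = herm_inner x (M *v y)"
    by (simp add: herm_inner_def matrix_vector_mult_def sum_distrib_left mult.assoc mult.left_commute)
  finally show ?thesis .
qed

text \<open>Adjoints are unique because the form is definite: the difference of the two images of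
  \<open>x\<close> is orthogonal to itself.\<close>

lemma conj_transpose_eqI:
  assumes "\<And>x y. herm_inner (L *v x) y = herm_inner x (M *v y)"
  shows "conj_transpose M = L"
proof -
  have "conj_transpose M *v x = L *v x" for x
  proof -
    let ?z = "conj_transpose M *v x - L *v x"
    have "herm_inner ?z ?z = cnj (herm_inner ?z (conj_transpose M *v x)) - cnj (herm_inner ?z (L *v x))"
      by (metis herm_inner_commute herm_inner_diff_right complex_cnj_diff)
    also have "\<dots> = 0"
      by (metis assms herm_inner_commute herm_inner_conj_transpose right_minus_eq)
    finally show ?thesis
      by (simp add: herm_inner_self_eq_0)
  qed
  then show ?thesis
    by (simp add: matrix_eq)
qed

text \<open>Moving \<open>M\<close> across the form, first for the pair \<open>x\<close>,
  \<open>x\<close> and then for \<open>x\<close>, \<open>y\<close>, shows that \<open>a\<close> is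
  real and that \<open>a\<close> and \<open>b\<close> scale \<open>herm_inner x y\<close> equally.
  The zero vector is split off, as it does not force \<open>a\<close> to be real.\<close>

lemma hermitian_eigenvectors_orthogonal:
  assumes "conj_transpose M = M" "M *v x = a *s x" "M *v y = b *s y" "a \<noteq> b"
  shows "herm_inner x y = 0"
proof (cases "x = 0")
  case False
  have "cnj a * herm_inner x x = a * herm_inner x x"
    using herm_inner_conj_transpose[of M x x] assms
    by (simp add: herm_inner_scale_left herm_inner_scale_right)
  then have "cnj a = a"
    using False by (simp add: herm_inner_self_eq_0)
  then have "a * herm_inner x y = b * herm_inner x y"
    using herm_inner_conj_transpose[of M x y] assms
    by (simp add: herm_inner_scale_left herm_inner_scale_right)
  then show ?thesis
    using assms(4) by simp
qed simp


section \<open>Orthogonal projections\<close>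

lemma orth_projection_mem: "is_orth_projection E U \<Longrightarrow> E *v x \<in> U"
  by (simp add: is_orth_projection_def)

lemma orth_projection_orthogonal:
  "is_orth_projection E U \<Longrightarrow> u \<in> U \<Longrightarrow> herm_inner u (x - E *v x) = 0"
  by (simp add: is_orth_projection_def)

text \<open>The difference of the two candidates lies in \<open>U\<close> and is orthogonal to
  \<open>U\<close>, hence to itself. Projections are evaluated below by exhibiting
  \<open>p\<close>.\<close>

lemma orth_projection_unique:
  assumes "is_orth_projection E U" "vec.subspace U" "p \<in> U"
    and "\<And>u. u \<in> U \<Longrightarrow> herm_inner u (x - p) = 0"
  shows "E *v x = p"
proof -
  let ?z = "E *v x - p"
  have z: "?z \<in> U"
    using assms orth_projection_mem vec.subspace_diff by blast
  have "herm_inner ?z ?z = herm_inner ?z (x - p) - herm_inner ?z (x - E *v x)"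
    by (simp add: herm_inner_diff_right)
  also have "\<dots> = 0"
    using assms(1,4) z orth_projection_orthogonal by simp
  finally show ?thesis
    by (simp add: herm_inner_self_eq_0)
qed

lemma orth_projection_fixes:
  assumes "is_orth_projection E U" "vec.subspace U" "u \<in> U"
  shows "E *v u = u"
  using orth_projection_unique[OF assms] by (simp add: herm_inner_def)

text \<open>What \<open>E\<close> removes from a vector is orthogonal to \<open>U\<close>, so both
  sides of the adjoint identity equal \<open>herm_inner (E *v x) (E *v y)\<close>.\<close>

lemma orth_projection_hermitian:
  assumes E: "is_orth_projection E U"
  shows "conj_transpose E = E"
proof (rule conj_transpose_eqI)
  fix x y
  have "herm_inner (E *v x) y = herm_inner (E *v x) (E *v y)"
    using orth_projection_orthogonal[OF E orth_projection_mem[OF E], of x y]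
    by (simp add: herm_inner_diff_right)
  also have "\<dots> = cnj (herm_inner (E *v y) (E *v x))"
    by (rule herm_inner_commute)
  also have "\<dots> = cnj (herm_inner (E *v y) x)"
    using orth_projection_orthogonal[OF E orth_projection_mem[OF E], of y x]
    by (simp add: herm_inner_diff_right)
  also have "\<dots> = herm_inner x (E *v y)"
    by (simp add: herm_inner_commute[of x])
  finally show "herm_inner (E *v x) y = herm_inner x (E *v y)" .
qed

text \<open>A Hermitian matrix that preserves \<open>U\<close> also preserves the orthogonal
  complement, so it respects the decomposition of \<open>x\<close> into its two components.\<close>

lemma orth_projection_commute:
  assumes E: "is_orth_projection E U" and U: "vec.subspace U"
    and M: "conj_transpose M = M" and inv: "\<And>u. u \<in> U \<Longrightarrow> M *v u \<in> U"
  shows "E *v (M *v x) = M *v (E *v x)"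
proof (rule orth_projection_unique[OF E U])
  show "M *v (E *v x) \<in> U"
    using E inv orth_projection_mem by blast
  fix u
  assume "u \<in> U"
  then have "herm_inner (M *v u) (x - E *v x) = 0"
    using E inv orth_projection_orthogonal by blast
  then show "herm_inner u (M *v x - M *v (E *v x)) = 0"
    using herm_inner_conj_transpose[of M] M by (simp add: matrix_vector_mult_diff_distrib)
qed


section \<open>The eigenspaces of a symmetric scheme\<close>

lemma conj_transpose_adj: "conj_transpose (adj S) = transpose (adj S)"
  by (simp add: conj_transpose_def transpose_def adj_def vec_eq_iff)

text \<open>The solution set is itself a common eigenspace containing \<open>U\<close>, so
  maximality forces equality. Thus the eigenvalues determine the space.\<close>

lemma maximal_common_eigenspace_eq:
  assumes max: "maximal_common_eigenspace d R U"
    and eig: "\<And>i w. i \<le> d \<Longrightarrow> w \<in> U \<Longrightarrow> adj (R i) *v w = \<theta> i *s w"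
  shows "U = {w. \<forall>i\<le>d. adj (R i) *v w = \<theta> i *s w}" (is "U = ?Z")
proof -
  have sub: "U \<subseteq> ?Z"
    using eig by auto
  have "vec.subspace ?Z"
    by (auto simp: vec.subspace_def matrix_vector_right_distrib vector_scalar_commute
        vec.scale_right_distrib mult.commute)
  moreover have "?Z \<noteq> {0}"
    using sub max vec.subspace_0
    by (fastforce simp: maximal_common_eigenspace_def common_eigenspace_def)
  ultimately have "common_eigenspace d R ?Z"
    by (auto simp: common_eigenspace_def)
  then show ?thesis
    using sub max by (auto simp: maximal_common_eigenspace_def)
qed

lemma maximal_common_eigenspaces_orthogonal:
  assumes sym: "symmetric_scheme d R"
    and U: "maximal_common_eigenspace d R U" and U': "maximal_common_eigenspace d R U'"
    and "U \<noteq> U'" "u \<in> U" "u' \<in> U'"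
  shows "herm_inner u u' = 0"
proof -
  obtain \<theta> where \<theta>: "\<And>i w. i \<le> d \<Longrightarrow> w \<in> U \<Longrightarrow> adj (R i) *v w = \<theta> i *s w"
    using U unfolding maximal_common_eigenspace_def common_eigenspace_def by metis
  obtain \<theta>' where \<theta>': "\<And>i w. i \<le> d \<Longrightarrow> w \<in> U' \<Longrightarrow> adj (R i) *v w = \<theta>' i *s w"
    using U' unfolding maximal_common_eigenspace_def common_eigenspace_def by metis
  \<comment> \<open>Eigenvalues agreeing for all indices up to \<open>d\<close> would give both
    spaces the same solution set.\<close>
  obtain i where i: "i \<le> d" "\<theta> i \<noteq> \<theta>' i"
    using maximal_common_eigenspace_eq[OF U \<theta>] maximal_common_eigenspace_eq[OF U' \<theta>'] \<open>U \<noteq> U'\<close>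
    by fastforce
  have "conj_transpose (adj (R i)) = adj (R i)"
    using sym i(1) by (simp add: conj_transpose_adj symmetric_scheme_def)
  then show ?thesis
    using hermitian_eigenvectors_orthogonal \<theta>[OF i(1) \<open>u \<in> U\<close>] \<theta>'[OF i(1) \<open>u' \<in> U'\<close>] i(2) by blast
qed

lemma matrix_scale_vector_mult: "matrix_scale c M *v x = c *s (M *v x)"
  by (simp add: matrix_scale_def matrix_vector_mult_def vec_eq_iff sum_distrib_left mult.assoc)

lemma sum_matrix_vector_mult: "(\<Sum>k\<in>K. f k) *v x = (\<Sum>k\<in>K. f k *v x)"
  for f :: "'k \<Rightarrow> complex^'n^'m"
  by (induction K rule: infinite_finite_induct) (simp_all add: matrix_vector_mult_add_rdistrib)

text \<open>Injectivity of \<open>W\<close> and orthogonality of distinct eigenspaces make every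
  \<open>E k\<close> with \<open>k \<noteq> j\<close> annihilate \<open>w\<close>, so one term of
  the expansion survives.\<close>

lemma scheme_eigenvalue:
  assumes sym: "symmetric_scheme d R"
    and W: "bij_betw W {..d} {U. maximal_common_eigenspace d R U}"
    and E: "\<And>j. j \<le> d \<Longrightarrow> is_orth_projection (E j) (W j)"
    and P: "adj (R i) = (\<Sum>j\<le>d. matrix_scale (P j i) (E j))"
    and j: "j \<le> d" and w: "w \<in> W j"
  shows "adj (R i) *v w = P j i *s w"
proof -
  have max: "maximal_common_eigenspace d R (W k)" if "k \<le> d" for k
    using bij_betwE[OF W] that by blast
  then have sub: "vec.subspace (W k)" if "k \<le> d" for k
    using that by (simp add: maximal_common_eigenspace_def common_eigenspace_def)
  have Ew: "E k *v w = (if k = j then w else 0)" if k: "k \<le> d" for k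
  proof (cases "k = j")
    case True
    then show ?thesis
      using orth_projection_fixes[OF E[OF j] sub[OF j] w] by simp
  next
    case False
    then have "W k \<noteq> W j"
      using inj_on_eq_iff[OF bij_betw_imp_inj_on[OF W]] j k by simp
    then have "herm_inner u w = 0" if "u \<in> W k" for u
      using maximal_common_eigenspaces_orthogonal[OF sym max[OF k] max[OF j]] that w by blast
    then have "E k *v w = 0"
      by (intro orth_projection_unique[OF E[OF k] sub[OF k] vec.subspace_0[OF sub[OF k]]]) simp
    then show ?thesis
      using False by simp
  qed
  have "adj (R i) *v w = (\<Sum>k\<le>d. P k i *s (E k *v w))"
    by (simp only: P sum_matrix_vector_mult matrix_scale_vector_mult)
  also have "\<dots> = (\<Sum>k\<le>d. if k = j then P j i *s w else 0)"
    by (rule sum.cong) (auto simp: Ew)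
  also have "\<dots> = P j i *s w"
    using j by (simp only: sum.delta finite_atMost atMost_iff if_True)
  finally show ?thesis .
qed


section \<open>The characteristic matrix\<close>

lemma column_space_eq_range: "column_space M = range ((*v) M)"
proof
  have sub: "vec.subspace (range ((*v) M))"
    by (rule vec.linear_subspace_image[OF matrix_vector_mul_linear_gen vec.subspace_UNIV])
  have "columns M \<subseteq> range ((*v) M)"
    by (auto simp: columns_def column_def matrix_vector_mult_def axis_def if_distrib image_iff
        cong: if_cong intro!: exI[of _ "axis _ 1"])
  then show "column_space M \<subseteq> range ((*v) M)"
    unfolding column_space_def using sub by (rule vec.span_minimal)
  show "range ((*v) M) \<subseteq> column_space M"
    by (auto simp: column_space_def matrix_vector_mult_in_columnspace_gen)
qed

lemma conj_transpose_char_matrix: "conj_transpose (char_matrix C) = transpose (char_matrix C)"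
  by (simp add: conj_transpose_def transpose_def char_matrix_def vec_eq_iff)

text \<open>With \<open>U = W j\<close> this turns the dimension in the theorem into the rank of
  \<open>F ** E j\<close>, which a trace can compute.\<close>

lemma dim_row_image_char_matrix:
  assumes F: "is_orth_projection F (column_space (char_matrix C))"
  shows "vec.dim (row_image U (char_matrix C)) = vec.dim ((*v) F ` U)"
proof -
  let ?H = "char_matrix C"
  let ?T = "\<lambda>w. w v* ?H"
  have "?T = (*v) (transpose ?H)"
    by (simp add: fun_eq_iff)
  then have lin: "Vector_Spaces.linear (*s) (*s) ?T"
    by (metis matrix_vector_mul_linear_gen)
  \<comment> \<open>The entries of \<open>?H\<close> are real, so its transpose is also its
    adjoint.\<close>
  have adjoint: "herm_inner (?T x) z = herm_inner x (?H *v z)" for x z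
    using herm_inner_conj_transpose[of ?H x z] by (simp add: conj_transpose_char_matrix)
  have kernel: "?T y = 0" if "\<And>u. u \<in> column_space ?H \<Longrightarrow> herm_inner u y = 0" for y
  proof -
    \<comment> \<open>Tested against \<open>?H *v ?T y\<close>, the vector \<open>y\<close> yields
      the squared length of \<open>?T y\<close>.\<close>
    have "herm_inner (?H *v ?T y) y = 0"
      by (rule that) (simp add: column_space_eq_range)
    then have "herm_inner y (?H *v ?T y) = 0"
      by (metis herm_inner_commute complex_cnj_zero)
    then show ?thesis
      using adjoint[of y "?T y"] by (simp add: herm_inner_self_eq_0)
  qed
  have TF: "?T (F *v w) = ?T w" for w
    using kernel[OF orth_projection_orthogonal[OF F]] by (simp add: vec.linear_diff[OF lin])
  have inj: "inj_on ?T (column_space ?H)"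
  proof (rule inj_onI)
    fix x y
    assume xy: "x \<in> column_space ?H" "y \<in> column_space ?H" "?T x = ?T y"
    then have "x - y \<in> column_space ?H"
      by (simp add: column_space_def vec.span_diff)
    then obtain z where z: "x - y = ?H *v z"
      by (auto simp: column_space_eq_range)
    have "herm_inner (x - y) (x - y) = herm_inner (?T (x - y)) z"
      by (simp only: z adjoint)
    also have "\<dots> = 0"
      using xy(3) by (simp add: vec.linear_diff[OF lin])
    finally show "x = y"
      by (simp add: herm_inner_self_eq_0)
  qed
  \<comment> \<open>Preservation of dimension asks for injectivity on the whole span.\<close>
  have span: "vec.span ((*v) F ` U) \<subseteq> column_space ?H"
    using orth_projection_mem[OF F] by (intro vec.span_minimal) (auto simp: column_space_def)
  have "row_image U ?H = ?T ` ((*v) F ` U)"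
    by (simp add: row_image_def image_image TF)
  then show ?thesis
    using vec.dim_image_eq[OF lin inj_on_subset[OF inj span]] by simp
qed


section \<open>The projection \<open>F\<close> on an eigenspace, and left eigenvectors of the
  quotient matrices\<close>

theorem theorem2:
  fixes d :: nat
    and R :: "nat \<Rightarrow> ('v::finite \<times> 'v) set"
    and W :: "nat \<Rightarrow> (complex^'v) set"
    and E :: "nat \<Rightarrow> complex^'v^'v"
    and P :: "nat \<Rightarrow> nat \<Rightarrow> complex"
    and C :: "'t::finite \<Rightarrow> 'v set"
    and N :: "nat \<Rightarrow> complex^'t^'t"
    and F :: "complex^'v^'v"
  assumes scheme: "symmetric_scheme d R"
    and eigenspaces: "bij_betw W {..d} {U. maximal_common_eigenspace d R U}"
    and idempotents: "\<And>j. j \<le> d \<Longrightarrow> is_orth_projection (E j) (W j)"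
    and eigenvalues: "\<And>i. i \<le> d \<Longrightarrow> adj (R i) = (\<Sum>j\<le>d. matrix_scale (P j i) (E j))"
    and equitable: "equitable_partition d R C"
    and quotients: "\<And>i. i \<le> d \<Longrightarrow> quotient_matrix C (adj (R i)) (N i)"
    and projection: "is_orth_projection F (column_space (char_matrix C))"
    and index: "j \<le> d"
  shows "matrix_inner F (E j) = of_nat (vec.dim (row_image (W j) (char_matrix C))) \<and>
    (\<forall>i\<le>d.
       left_eigen_multiplicity (N i) (P j i) (row_image (W j) (char_matrix C)) =
         vec.dim (row_image (W j) (char_matrix C)) \<and>
       (\<forall>u\<in>row_image (W j) (char_matrix C). u v* N i = P j i *s u))"
proof -
  let ?H = "char_matrix C"
  let ?Y = "column_space ?H"
  have max: "maximal_common_eigenspace d R (W j)"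
    using bij_betwE[OF eigenspaces] index by blast
  then have sub: "vec.subspace (W j)"
    by (simp add: maximal_common_eigenspace_def common_eigenspace_def)
  have subY: "vec.subspace ?Y"
    by (simp add: column_space_def)
  have eig: "adj (R i) *v w = P j i *s w" if "i \<le> d" "w \<in> W j" for i w
    using scheme eigenspaces idempotents eigenvalues[OF that(1)] index that(2)
    by (rule scheme_eigenvalue)
  have Weq: "W j = {w. \<forall>i\<le>d. adj (R i) *v w = P j i *s w}"
    using maximal_common_eigenspace_eq[OF max eig] .
  have invY: "adj (R i) *v y \<in> ?Y" if "i \<le> d" "y \<in> ?Y" for i y
    using that quotients[OF that(1)]
    by (auto simp: column_space_eq_range quotient_matrix_def matrix_vector_mul_assoc)
      (simp flip: matrix_vector_mul_assoc)
  have comm: "F *v (adj (R i) *v x) = adj (R i) *v (F *v x)" if "i \<le> d" for i x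
    using orth_projection_commute[OF projection subY _ invY] scheme that
    by (simp add: conj_transpose_adj symmetric_scheme_def)
  \<comment> \<open>Commuting with \<open>F\<close> carries the eigenvalue equations from
    \<open>w\<close> to \<open>F *v w\<close>, and by \<open>Weq\<close> these equations decide
    membership.\<close>
  have FW: "F *v w \<in> W j" if "w \<in> W j" for w
    using that by (subst Weq) (simp add: eig vector_scalar_commute flip: comm)
  have Ej: "E j *v w = w" if "w \<in> W j" for w
    using orth_projection_fixes[OF idempotents[OF index] sub that] .
  \<comment> \<open>\<open>F *v (E j *v x)\<close> lies in both \<open>W j\<close> and
    \<open>?Y\<close>, so \<open>E j\<close> and \<open>F\<close> each fix it.\<close>
  have FEFE: "F *v (E j *v (F *v (E j *v x))) = F *v (E j *v x)" for x
    using Ej[OF FW[OF orth_projection_mem[OF idempotents[OF index]]]]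
      orth_projection_fixes[OF projection subY orth_projection_mem[OF projection]]
    by simp
  have idem: "(F ** E j) ** (F ** E j) = F ** E j"
    by (simp add: matrix_eq FEFE flip: matrix_vector_mul_assoc)
  have "range ((*v) (E j)) = W j"
    using Ej orth_projection_mem[OF idempotents[OF index]] by (metis image_subsetI rangeI subsetI subset_antisym)
  moreover have "range ((*v) (F ** E j)) = (*v) F ` range ((*v) (E j))"
    by (simp add: image_image matrix_vector_mul_assoc)
  ultimately have range: "range ((*v) (F ** E j)) = (*v) F ` W j"
    by simp
  have "matrix_inner F (E j) = trace (F ** E j)"
    by (simp add: matrix_inner_def orth_projection_hermitian[OF projection])
  then have inner: "matrix_inner F (E j) = of_nat (vec.dim (row_image (W j) ?H))"
    by (simp add: trace_idempotent[OF idem] range dim_row_image_char_matrix[OF projection])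
  have row: "u v* N i = P j i *s u" if i: "i \<le> d" and u: "u \<in> row_image (W j) ?H" for i u
  proof -
    obtain w where w: "w \<in> W j" "u = w v* ?H"
      using u by (auto simp: row_image_def)
    have "u v* N i = w v* (adj (R i) ** ?H)"
      using quotients[OF i] w(2) by (simp add: quotient_matrix_def vector_matrix_mul_assoc)
    \<comment> \<open>Passing to the transpose turns the action on row vectors into one on columns;
      symmetry of the relation then makes \<open>eig\<close> applicable.\<close>
    also have "\<dots> = (transpose (adj (R i)) *v w) v* ?H"
      by (simp add: vector_matrix_mul_assoc)
    also have "\<dots> = (P j i *s w) v* ?H"
      using scheme i eig[OF i w(1)] by (simp add: symmetric_scheme_def)
    also have "\<dots> = P j i *s u"
      by (simp add: w(2) scalar_vector_matrix_assoc)
    finally show ?thesis .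
  qed
  then have "{u \<in> row_image (W j) ?H. u v* N i = P j i *s u} = row_image (W j) ?H" if "i \<le> d" for i
    using that by blast
  then show ?thesis
    using inner row by (simp add: left_eigen_multiplicity_def)
qed

end
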